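(* Let $E$ be a Dedekind complete Riesz space and let $(P_n)_{n\ge 1}$ be a sequence of band projections in $E$. Then $$\limsup_{n\to\infty} P_n-\liminf_{n\to\infty} P_n=\limsup_{n\to\infty} P_n(I-P_{n+1}).$$
   Context: Here $I$ is the identity operator on $E$, and products of band projections are compositions (band projections commute, and a product of band projections is a band projection). Band projections are ordered as operators: $P\le Q$ iff $Pf\le Qf$ for all $f\in E$ with $f\ge 0$. Since $E$ is Dedekind complete, the band projections on $E$ form a complete Boolean algebra under this order, with $P\wedge Q=PQ$ and complement $I-P$. For a sequence $(P_n)$ of band projections, $\limsup_{n\to\infty}P_n=\bigwedge_{k\ge1}\bigvee_{n\ge k}P_n$ and $\liminf_{n\to\infty}P_n=\bigvee_{k\ge1}\bigwedge_{n\ge k}P_n$. The difference on the left-hand side is the difference of operators. *)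

theory Defs
  imports Complex_Main "HOL-Library.Lattice_Algebras"
begin

(* Every nonempty subset that is bounded above has a supremum, every nonempty subset that is
   bounded below has an infimum, and \<bar>f\<bar> = sup f (- f). *)
class dedekind_complete_riesz_space =
  ordered_real_vector + lattice_ab_group_add_abs + conditionally_complete_lattice

instance real :: dedekind_complete_riesz_space ..

definition riesz_ideal :: "'a::dedekind_complete_riesz_space set \<Rightarrow> bool" where
  "riesz_ideal A \<longleftrightarrow> subspace A \<and> (\<forall>f g. g \<in> A \<and> \<bar>f\<bar> \<le> \<bar>g\<bar> \<longrightarrow> f \<in> A)"

(* By Dedekind completeness the subsets of A that have a supremum in the whole space are the
   nonempty ones that are bounded above (the empty set has one only in the zero space). *)
definition band :: "'a::dedekind_complete_riesz_space set \<Rightarrow> bool" where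
  "band A \<longleftrightarrow> riesz_ideal A \<and> (\<forall>S\<subseteq>A. S \<noteq> {} \<and> bdd_above S \<longrightarrow> Sup S \<in> A)"

definition disjoint_complement ::
    "'a::dedekind_complete_riesz_space set \<Rightarrow> 'a set" where
  "disjoint_complement A = {f. \<forall>g\<in>A. inf \<bar>f\<bar> \<bar>g\<bar> = 0}"

(* P is the projection onto some band B along its disjoint complement. *)
definition band_projection :: "('a::dedekind_complete_riesz_space \<Rightarrow> 'a) \<Rightarrow> bool" where
  "band_projection P \<longleftrightarrow>
     (\<exists>B. band B \<and> (\<forall>f. P f \<in> B \<and> f - P f \<in> disjoint_complement B))"

(* The order of operators compares values on the positive cone only; it is not the pointwise
   order that the library puts on functions. *)
definition op_le ::
    "('a::dedekind_complete_riesz_space \<Rightarrow> 'a) \<Rightarrow> ('a \<Rightarrow> 'a) \<Rightarrow> bool" where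
  "op_le P Q \<longleftrightarrow> (\<forall>f\<ge>0. P f \<le> Q f)"

(* Supremum and infimum are taken in the set of band projections ordered by op_le, which is a
   complete Boolean algebra; the descriptions are only meant for sets of band projections. *)
definition bp_Sup ::
    "('a::dedekind_complete_riesz_space \<Rightarrow> 'a) set \<Rightarrow> ('a \<Rightarrow> 'a)" where
  "bp_Sup \<P> = (THE Q. band_projection Q \<and> (\<forall>P\<in>\<P>. op_le P Q) \<and>
     (\<forall>R. band_projection R \<and> (\<forall>P\<in>\<P>. op_le P R) \<longrightarrow> op_le Q R))"

definition bp_Inf ::
    "('a::dedekind_complete_riesz_space \<Rightarrow> 'a) set \<Rightarrow> ('a \<Rightarrow> 'a)" where
  "bp_Inf \<P> = (THE Q. band_projection Q \<and> (\<forall>P\<in>\<P>. op_le Q P) \<and>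
     (\<forall>R. band_projection R \<and> (\<forall>P\<in>\<P>. op_le R P) \<longrightarrow> op_le R Q))"

(* Sequences are indexed by n \<ge> 1; the value at 0 is not used. *)
definition bp_limsup ::
    "(nat \<Rightarrow> 'a::dedekind_complete_riesz_space \<Rightarrow> 'a) \<Rightarrow> ('a \<Rightarrow> 'a)" where
  "bp_limsup P = bp_Inf ((\<lambda>k. bp_Sup (P ` {k..})) ` {1..})"

definition bp_liminf ::
    "(nat \<Rightarrow> 'a::dedekind_complete_riesz_space \<Rightarrow> 'a) \<Rightarrow> ('a \<Rightarrow> 'a)" where
  "bp_liminf P = bp_Sup ((\<lambda>k. bp_Inf (P ` {k..})) ` {1..})"

end

theory Submission
  imports Defs
begin

text \<open>
  The proof moves everything to single vectors. A band projection is the same thing as a linear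
  idempotent \<open>P\<close> with \<open>0 \<le> P f \<le> f\<close> on the positive cone
  (\<open>band_projection_iff_component_operator\<close>). Any two such operators commute, because on positive
  vectors both products equal the pointwise infimum (\<open>component_operator_comp_eq_inf\<close>), and such an
  operator is determined by its fixed points. Riesz' theorem that every band is the range of a band
  projection then makes the lattice operations concrete: the fixed points of an infimum are the
  common fixed points of the family (\<open>bp_Inf_component_operator\<close>), and by complementation the kernel
  of a supremum is the common kernel (\<open>bp_Sup_component_operator\<close>).

  Write \<open>L\<close> and \<open>l\<close> for the upper and lower limit of \<open>P\<close>, and \<open>M\<close> for the upper limit of
  \<open>D n = P n (I - P (n + 1))\<close>. The operator \<open>D n\<close> detects a descent of the sequence at \<open>n\<close>. A vector
  on which no descent happens from some \<open>k\<close> on satisfies \<open>P (n + 1) (P n h) = P n h\<close> for \<open>n \<ge> k\<close>, so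
  that each \<open>P n h\<close> is fixed by all later projections and hence lies in the range of \<open>l\<close>. If moreover
  \<open>l h = 0\<close>, then \<open>P n h = 0\<close> for all \<open>n \<ge> k\<close>, so \<open>L h = 0\<close>. This shows that the range of \<open>L - l\<close> lies
  in that of \<open>M\<close>. Conversely, let \<open>M g = g\<close>. Then for every \<open>k\<close> the vector \<open>g\<close> is fixed by the supremum
  of the \<open>D n\<close> with \<open>n \<ge> k\<close>. The part of \<open>g\<close> annihilated by all \<open>P n\<close> with \<open>n \<ge> k\<close> and the part fixed by
  all of them are also annihilated by all these \<open>D n\<close>, so both parts are 0 for every \<open>k\<close>; that is,
  \<open>L g = g\<close> and \<open>l g = 0\<close>.
\<close>

section \<open>Band projections as positive idempotents below the identity\<close>

lemma scaleR_abs_le: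
  fixes f :: "'a::dedekind_complete_riesz_space"
  shows "\<bar>c *\<^sub>R f\<bar> \<le> \<bar>c\<bar> *\<^sub>R \<bar>f\<bar>"
proof (rule abs_leI)
  have *: "a *\<^sub>R f \<le> \<bar>a\<bar> *\<^sub>R \<bar>f\<bar>" for a
  proof (cases "a \<ge> 0")
    case True
    then show ?thesis by (simp add: scaleR_left_mono abs_ge_self)
  next
    case False
    then have "(- a) *\<^sub>R (- f) \<le> (- a) *\<^sub>R \<bar>f\<bar>"
      by (intro scaleR_left_mono abs_ge_minus_self) auto
    with False show ?thesis by simp
  qed
  from *[of c] show "c *\<^sub>R f \<le> \<bar>c\<bar> *\<^sub>R \<bar>f\<bar>" .
  from *[of "- c"] show "- (c *\<^sub>R f) \<le> \<bar>c\<bar> *\<^sub>R \<bar>f\<bar>" by simp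
qed

lemma subspace_disjoint_complement:
  fixes A :: "'a::dedekind_complete_riesz_space set"
  shows "subspace (disjoint_complement A)"
proof (rule subspaceI)
  show "0 \<in> disjoint_complement A"
    by (simp add: disjoint_complement_def inf_absorb1)
next
  fix x y assume "x \<in> disjoint_complement A" "y \<in> disjoint_complement A"
  then have d: "inf \<bar>x\<bar> \<bar>g\<bar> = 0" "inf \<bar>y\<bar> \<bar>g\<bar> = 0" if "g \<in> A" for g
    using that by (auto simp: disjoint_complement_def)
  have "inf \<bar>x + y\<bar> \<bar>g\<bar> = 0" if g: "g \<in> A" for g
  proof (rule antisym)
    define h where "h = inf \<bar>x + y\<bar> \<bar>g\<bar>"
    have hg: "h \<le> \<bar>g\<bar>" and "h \<le> \<bar>x + y\<bar>"
      unfolding h_def by auto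
    then have "h \<le> \<bar>x\<bar> + \<bar>y\<bar>"
      using abs_triangle_ineq[of x y] by (metis order_trans)
    then have "h - \<bar>y\<bar> \<le> \<bar>x\<bar>" by (simp add: algebra_simps)
    moreover have "h - \<bar>y\<bar> \<le> \<bar>g\<bar>"
      using hg abs_ge_zero[of y] by (metis add_increasing2 diff_le_eq)
    ultimately have "h - \<bar>y\<bar> \<le> inf \<bar>x\<bar> \<bar>g\<bar>" by simp
    then have "h \<le> \<bar>y\<bar>" using d(1)[OF g] by simp
    with hg have "h \<le> inf \<bar>y\<bar> \<bar>g\<bar>" by simp
    then show "inf \<bar>x + y\<bar> \<bar>g\<bar> \<le> 0" using d(2)[OF g] by (simp add: h_def)
  qed simp
  then show "x + y \<in> disjoint_complement A" by (simp add: disjoint_complement_def)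
next
  fix c :: real and x assume x: "x \<in> disjoint_complement A"
  have "inf \<bar>c *\<^sub>R x\<bar> \<bar>g\<bar> = 0" if g: "g \<in> A" for g
  proof (rule antisym)
    define h where "h = inf \<bar>c *\<^sub>R x\<bar> \<bar>g\<bar>"
    \<comment> \<open>Dividing by a number that is at least 1 as well as at least \<open>\<bar>c\<bar>\<close> brings \<open>h\<close> below \<open>\<bar>x\<bar>\<close>
      and keeps it below \<open>\<bar>g\<bar>\<close>.\<close>
    define r where "r = max 1 \<bar>c\<bar>"
    have r: "r > 0" "r \<ge> 1" "\<bar>c\<bar> \<le> r" unfolding r_def by auto
    have h0: "0 \<le> h" unfolding h_def by simp
    have "h \<le> \<bar>c\<bar> *\<^sub>R \<bar>x\<bar>"
      unfolding h_def by (rule order_trans[OF inf_le1 scaleR_abs_le])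
    also have "\<dots> \<le> r *\<^sub>R \<bar>x\<bar>" using r by (intro scaleR_right_mono) auto
    finally have "inverse r *\<^sub>R h \<le> inverse r *\<^sub>R (r *\<^sub>R \<bar>x\<bar>)"
      using r by (intro scaleR_left_mono) auto
    then have 1: "inverse r *\<^sub>R h \<le> \<bar>x\<bar>" using r by simp
    have "inverse r *\<^sub>R h \<le> 1 *\<^sub>R h"
      using r h0 by (intro scaleR_right_mono) (auto simp: inverse_le_1_iff)
    also have "\<dots> \<le> \<bar>g\<bar>" unfolding h_def by simp
    finally have "inverse r *\<^sub>R h \<le> inf \<bar>x\<bar> \<bar>g\<bar>" using 1 by simp
    also have "\<dots> = 0" using x g by (simp add: disjoint_complement_def)
    finally have "r *\<^sub>R (inverse r *\<^sub>R h) \<le> r *\<^sub>R 0"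
      using r by (intro scaleR_left_mono) auto
    then show "inf \<bar>c *\<^sub>R x\<bar> \<bar>g\<bar> \<le> 0" using r by (simp add: h_def)
  qed simp
  then show "c *\<^sub>R x \<in> disjoint_complement A" by (simp add: disjoint_complement_def)
qed

lemma disjoint_complement_Int:
  assumes "f \<in> A" "f \<in> disjoint_complement A"
  shows "f = 0"
  using assms by (auto simp: disjoint_complement_def)

text \<open>Disjoint summands of a positive vector cannot cancel each other: the negative part of \<open>b\<close> would
  have to be compensated by \<open>d\<close>, so it lies below both \<open>\<bar>b\<bar>\<close> and \<open>\<bar>d\<bar>\<close>, whose infimum is 0.\<close>

lemma disjoint_add_nonneg:
  fixes b d :: "'a::dedekind_complete_riesz_space"
  assumes "inf \<bar>d\<bar> \<bar>b\<bar> = 0" "0 \<le> b + d"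
  shows "0 \<le> b"
proof -
  have "- b \<le> d" using add_left_mono[OF assms(2), of "- b"] by simp
  also have "d \<le> \<bar>d\<bar>" by (rule abs_ge_self)
  finally have "- b \<le> inf \<bar>d\<bar> \<bar>b\<bar>" by (simp add: abs_ge_minus_self)
  then show ?thesis using assms(1) by simp
qed

text \<open>The positive operators that are components of the identity. They turn out to be exactly the band
  projections; this form makes no reference to a band and so is convenient for calculations.\<close>

definition component_operator :: "('a::dedekind_complete_riesz_space \<Rightarrow> 'a) \<Rightarrow> bool" where
  "component_operator P \<longleftrightarrow>
     linear P \<and> (\<forall>f. P (P f) = P f) \<and> (\<forall>f\<ge>0. 0 \<le> P f \<and> P f \<le> f)"

text \<open>A band meets its disjoint complement only in 0, so the decomposition of a vector is unique;
  this uniqueness forces \<open>P\<close> to be linear and idempotent. The bounds hold because the two components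
  of a positive vector are disjoint and hence positive.\<close>

lemma component_operator_of_band:
  assumes "band B" and P: "\<And>f. P f \<in> B \<and> f - P f \<in> disjoint_complement B"
  shows "component_operator P"
proof -
  have sB: "subspace B" using assms(1) by (simp add: band_def riesz_ideal_def)
  note sD = subspace_disjoint_complement[of B]
  have uniq: "P f = b" if "b \<in> B" "f - b \<in> disjoint_complement B" for f b
  proof -
    have "P f - b \<in> B" using subspace_diff[OF sB] P that by blast
    moreover have "(f - b) - (f - P f) \<in> disjoint_complement B"
      using subspace_diff[OF sD] P that by blast
    ultimately show ?thesis using disjoint_complement_Int[of "P f - b" B] by simp
  qed
  have "linear P"
  proof (rule linearI)
    fix f g
    have "(f - P f) + (g - P g) \<in> disjoint_complement B" using subspace_add[OF sD] P by blast
    then show "P (f + g) = P f + P g"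
      using subspace_add[OF sB] P by (intro uniq) (auto simp: algebra_simps)
  next
    fix c f
    have "c *\<^sub>R (f - P f) \<in> disjoint_complement B" using subspace_scale[OF sD] P by blast
    then show "P (c *\<^sub>R f) = c *\<^sub>R P f"
      using subspace_scale[OF sB] P by (intro uniq) (auto simp: algebra_simps)
  qed
  moreover have "P (P f) = P f" for f
    using P subspace_0[OF sD] by (intro uniq) auto
  moreover have "0 \<le> P f \<and> P f \<le> f" if f: "0 \<le> f" for f
  proof -
    have d: "inf \<bar>f - P f\<bar> \<bar>P f\<bar> = 0" using P by (auto simp: disjoint_complement_def)
    have "0 \<le> P f" by (rule disjoint_add_nonneg[OF d]) (use f in simp)
    moreover have "0 \<le> f - P f"
      by (rule disjoint_add_nonneg[of "P f"]) (use f d in \<open>simp_all add: inf.commute\<close>)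
    ultimately show ?thesis by simp
  qed
  ultimately show ?thesis by (simp add: component_operator_def)
qed

context
  fixes P :: "'a::dedekind_complete_riesz_space \<Rightarrow> 'a"
  assumes P: "component_operator P"
begin

lemma component_operator_simps:
  "P (f + g) = P f + P g" "P (f - g) = P f - P g" "P (- f) = - P f" "P 0 = 0"
  "P (c *\<^sub>R f) = c *\<^sub>R P f" "P (P f) = P f"
  using P unfolding component_operator_def
  by (auto simp: linear_add linear_diff linear_neg linear_0 linear_scale)

lemma component_operator_bounds:
  assumes "0 \<le> f" shows "0 \<le> P f" "P f \<le> f"
  using P assms unfolding component_operator_def by auto

lemma component_operator_mono:
  assumes "f \<le> g" shows "P f \<le> P g"
  using component_operator_bounds(1)[of "g - f"] assms by (simp add: component_operator_simps)

lemma component_operator_compl: "component_operator (\<lambda>f. f - P f)"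
  unfolding component_operator_def
  by (auto intro!: linearI simp: component_operator_simps component_operator_bounds algebra_simps)

lemma component_operator_abs_le: "\<bar>P f\<bar> \<le> P \<bar>f\<bar>"
  using component_operator_mono[OF abs_ge_self[of f]]
    component_operator_mono[OF abs_ge_minus_self[of f]]
  by (intro abs_leI) (simp_all add: component_operator_simps)

lemma component_operator_fixed_abs:
  assumes "P g = g" shows "P \<bar>g\<bar> = \<bar>g\<bar>"
  using component_operator_abs_le[of g] component_operator_bounds(2)[of "\<bar>g\<bar>"] assms
  by (simp add: antisym)

end

text \<open>A fixed point is a zero of the complementary projection, which is positive, so the fixed points
  form a solid set.\<close>

lemma band_fixed_points:
  assumes P: "component_operator P"
  shows "band {f. P f = f}"
proof -
  note s = component_operator_simps[OF P]
  have "P f = f" if g: "P g = g" and fg: "\<bar>f\<bar> \<le> \<bar>g\<bar>" for f g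
  proof -
    note Q = component_operator_compl[OF P]
    have "\<bar>f - P f\<bar> \<le> \<bar>f\<bar> - P \<bar>f\<bar>" by (rule component_operator_abs_le[OF Q])
    also have "\<dots> \<le> \<bar>g\<bar> - P \<bar>g\<bar>" by (rule component_operator_mono[OF Q fg])
    also have "\<dots> = 0" using component_operator_fixed_abs[OF P g] by simp
    finally show ?thesis by simp
  qed
  moreover have "P (Sup S) = Sup S"
    if S: "S \<subseteq> {f. P f = f}" "S \<noteq> {}" "bdd_above S" for S
  proof (rule antisym)
    obtain x where x: "x \<in> S" using S by blast
    then have "x \<le> Sup S" using S by (intro cSup_upper)
    \<comment> \<open>Translating by a member of \<open>S\<close> makes the supremum positive.\<close>
    then have "P (Sup S - x) \<le> Sup S - x" by (intro component_operator_bounds[OF P]) simp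
    then show "P (Sup S) \<le> Sup S" using S x by (auto simp: s)
    show "Sup S \<le> P (Sup S)"
    proof (rule cSup_least)
      fix y assume "y \<in> S"
      then show "y \<le> P (Sup S)"
        using S component_operator_mono[OF P, of y "Sup S"] cSup_upper[of y S] by auto
    qed (use S in auto)
  qed
  ultimately show ?thesis
    unfolding band_def riesz_ideal_def by (auto intro!: subspaceI simp: s)
qed

text \<open>A positive vector below \<open>\<bar>f - P f\<bar> \<le> \<bar>f\<bar> - P \<bar>f\<bar>\<close> is annihilated by \<open>P\<close>, and one below the
  absolute value of a fixed point is fixed by \<open>P\<close>; only 0 is both.\<close>

lemma component_operator_disjoint:
  assumes P: "component_operator P"
  shows "f - P f \<in> disjoint_complement {f. P f = f}"
proof -
  note Q = component_operator_compl[OF P]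
  have "inf \<bar>f - P f\<bar> \<bar>g\<bar> = 0" if g: "P g = g" for g
  proof (rule antisym)
    define h where "h = inf \<bar>f - P f\<bar> \<bar>g\<bar>"
    have h0: "0 \<le> h" unfolding h_def by simp
    have "h \<le> \<bar>f\<bar> - P \<bar>f\<bar>"
      unfolding h_def by (rule order_trans[OF inf_le1 component_operator_abs_le[OF Q]])
    from component_operator_mono[OF P this]
    have "P h \<le> 0" by (simp add: component_operator_simps[OF P])
    moreover have "h - P h \<le> \<bar>g\<bar> - P \<bar>g\<bar>"
      by (rule component_operator_mono[OF Q]) (simp add: h_def)
    then have "h \<le> P h" by (simp add: component_operator_fixed_abs[OF P g])
    ultimately show "inf \<bar>f - P f\<bar> \<bar>g\<bar> \<le> 0" unfolding h_def by (rule order_trans[rotated])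
  qed simp
  then show ?thesis by (simp add: disjoint_complement_def)
qed

theorem band_projection_iff_component_operator:
  "band_projection P \<longleftrightarrow> component_operator P"
proof
  show "component_operator P" if "band_projection P"
    using that component_operator_of_band unfolding band_projection_def by metis
  show "band_projection P" if P: "component_operator P"
    unfolding band_projection_def
    using band_fixed_points[OF P] component_operator_disjoint[OF P]
    by (intro exI[of _ "{f. P f = f}"]) (simp add: component_operator_simps[OF P])
qed

text \<open>The reason why band projections commute: the right-hand side is symmetric in \<open>P\<close> and \<open>Q\<close>.\<close>

lemma component_operator_comp_eq_inf:
  assumes P: "component_operator P" and Q: "component_operator Q" and f: "0 \<le> f"
  shows "P (Q f) = inf (P f) (Q f)"
proof (rule antisym)
  note bP = component_operator_bounds[OF P] and bQ = component_operator_bounds[OF Q]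
  show "P (Q f) \<le> inf (P f) (Q f)"
    using bP bQ f component_operator_mono[OF P] by simp
  define h where "h = inf (P f) (Q f)"
  have h: "0 \<le> h" "h \<le> P f" "h \<le> Q f" using bP bQ f by (auto simp: h_def)
  have "P h = h"
    using component_operator_mono[OF component_operator_compl[OF P] h(2)] bP(2)[OF h(1)]
    by (simp add: component_operator_simps[OF P] antisym)
  moreover have "P h \<le> P (Q f)" by (rule component_operator_mono[OF P h(3)])
  ultimately show "inf (P f) (Q f) \<le> P (Q f)" by (simp add: h_def)
qed

lemma linear_eq_of_eq_on_nonneg:
  fixes S T :: "'a::dedekind_complete_riesz_space \<Rightarrow> 'a"
  assumes "linear S" "linear T" "\<And>f. 0 \<le> f \<Longrightarrow> S f = T f"
  shows "S f = T f"
proof -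
  have "S f = S (pprt f) - S (- nprt f)" "T f = T (pprt f) - T (- nprt f)"
    using assms(1,2) by (simp_all flip: linear_diff add: prts[symmetric])
  then show ?thesis using assms(3)[of "pprt f"] assms(3)[of "- nprt f"] by simp
qed

lemma component_operator_commute:
  assumes P: "component_operator P" and Q: "component_operator Q"
  shows "P (Q f) = Q (P f)"
proof (rule linear_eq_of_eq_on_nonneg[where S = "\<lambda>f. P (Q f)" and T = "\<lambda>f. Q (P f)"])
  show "linear (\<lambda>f. P (Q f))" "linear (\<lambda>f. Q (P f))"
    by (auto intro!: linearI simp: component_operator_simps[OF P] component_operator_simps[OF Q])
  show "P (Q f) = Q (P f)" if "0 \<le> f" for f
    using that by (simp add: component_operator_comp_eq_inf P Q inf.commute)
qed

lemma component_operator_comp: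
  assumes P: "component_operator P" and Q: "component_operator Q"
  shows "component_operator (P \<circ> Q)"
  unfolding component_operator_def comp_def
proof (intro conjI allI impI)
  note s = component_operator_simps[OF P] component_operator_simps[OF Q]
  show "linear (\<lambda>f. P (Q f))" by (auto intro!: linearI simp: s)
  show "P (Q (P (Q f))) = P (Q f)" for f
    by (simp add: component_operator_commute[OF Q P] s)
  fix f :: 'a assume f: "0 \<le> f"
  note b = component_operator_bounds[OF P] component_operator_bounds[OF Q]
  show "0 \<le> P (Q f)" "P (Q f) \<le> f" using b f by (auto intro: order_trans[of _ "Q f"])
qed

text \<open>The order of band projections is the inclusion of their ranges, that is, of their sets of fixed
  points.\<close>

lemma op_le_iff_fixed:
  assumes P: "component_operator P" and Q: "component_operator Q"
  shows "op_le P Q \<longleftrightarrow> (\<forall>f. P f = f \<longrightarrow> Q f = f)"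
proof
  note s = component_operator_simps[OF P] component_operator_simps[OF Q]
  assume le: "op_le P Q"
  have "Q (P f) = P f" for f
  proof (rule linear_eq_of_eq_on_nonneg[where S = "\<lambda>f. Q (P f)" and T = P])
    show "linear (\<lambda>f. Q (P f))" "linear P"
      by (auto intro!: linearI simp: s)
    fix f :: 'a assume "0 \<le> f"
    then have "0 \<le> P f" by (rule component_operator_bounds[OF P])
    with le show "Q (P f) = P f"
      using component_operator_bounds(2)[OF Q, of "P f"] unfolding op_le_def
      by (metis s(6) antisym)
  qed
  then show "\<forall>f. P f = f \<longrightarrow> Q f = f" by metis
next
  assume *: "\<forall>f. P f = f \<longrightarrow> Q f = f"
  show "op_le P Q" unfolding op_le_def
  proof (intro allI impI)
    fix f :: 'a assume "0 \<le> f"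
    then have "Q (P f) \<le> Q f"
      by (intro component_operator_mono[OF Q] component_operator_bounds[OF P])
    then show "P f \<le> Q f" using * by (simp add: component_operator_simps[OF P])
  qed
qed

lemma component_operator_eqI:
  assumes P: "component_operator P" and Q: "component_operator Q"
    and "\<And>f. P f = f \<longleftrightarrow> Q f = f"
  shows "P = Q"
  using component_operator_commute[OF P Q] component_operator_simps(6)[OF P]
    component_operator_simps(6)[OF Q] assms(3) by (metis ext)

section \<open>Every band is the range of a band projection\<close>

lemma band_solid:
  assumes "band B" "g \<in> B" "\<bar>f\<bar> \<le> \<bar>g\<bar>" shows "f \<in> B"
  using assms unfolding band_def riesz_ideal_def by blast

lemma band_Sup:
  assumes "band B" "S \<subseteq> B" "S \<noteq> {}" "bdd_above S" shows "Sup S \<in> B"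
  using assms unfolding band_def by simp

text \<open>The component of a positive \<open>f\<close> in \<open>B\<close> is the largest element of \<open>B\<close> between 0 and \<open>f\<close>. If the
  rest of \<open>f\<close> were not disjoint from \<open>B\<close>, then some positive part of it could be added to this
  largest element.\<close>

lemma band_decomposition_nonneg:
  fixes f :: "'a::dedekind_complete_riesz_space"
  assumes B: "band B" and f: "0 \<le> f"
  shows "\<exists>b\<in>B. f - b \<in> disjoint_complement B"
proof
  define S where "S = {g \<in> B. 0 \<le> g \<and> g \<le> f}"
  have sB: "subspace B" using B by (simp add: band_def riesz_ideal_def)
  have S0: "0 \<in> S" using f subspace_0[OF sB] by (simp add: S_def)
  have bdd: "bdd_above S" unfolding S_def by (rule bdd_aboveI[of _ f]) simp
  show b: "Sup S \<in> B" using B S0 bdd by (intro band_Sup) (auto simp: S_def)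
  have b0: "0 \<le> Sup S" by (rule cSup_upper[OF S0 bdd])
  have bf: "Sup S \<le> f" using S0 by (intro cSup_least) (auto simp: S_def)
  have "inf \<bar>f - Sup S\<bar> \<bar>g\<bar> = 0" if g: "g \<in> B" for g
  proof (rule antisym)
    define h where "h = inf \<bar>f - Sup S\<bar> \<bar>g\<bar>"
    have h0: "0 \<le> h" by (simp add: h_def)
    have hf: "h \<le> f - Sup S" using bf unfolding h_def by (metis abs_of_nonneg diff_ge_0_iff_ge inf_le1)
    have "h \<in> B" using h0 by (intro band_solid[OF B g]) (simp add: h_def)
    then have "Sup S + h \<in> S" using b b0 h0 hf subspace_add[OF sB] by (simp add: S_def algebra_simps)
    then have "Sup S + h \<le> Sup S" using bdd by (rule cSup_upper)
    then show "inf \<bar>f - Sup S\<bar> \<bar>g\<bar> \<le> 0" by (simp add: h_def)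
  qed simp
  then show "f - Sup S \<in> disjoint_complement B" by (simp add: disjoint_complement_def)
qed

lemma band_component_operator_exists:
  assumes B: "band B"
  shows "\<exists>P. component_operator P \<and> (\<forall>f. P f = f \<longleftrightarrow> f \<in> B)"
proof -
  have sB: "subspace B" using B by (simp add: band_def riesz_ideal_def)
  note sD = subspace_disjoint_complement[of B]
  have "\<exists>b. b \<in> B \<and> f - b \<in> disjoint_complement B" for f
  proof -
    obtain b c where b: "b \<in> B" "pprt f - b \<in> disjoint_complement B"
      and c: "c \<in> B" "- nprt f - c \<in> disjoint_complement B"
      using band_decomposition_nonneg[OF B, of "pprt f"]
        band_decomposition_nonneg[OF B, of "- nprt f"] by auto
    have "f - (b - c) = (pprt f - b) - (- nprt f - c)"
      by (subst prts[of f]) (simp add: algebra_simps)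
    then show ?thesis
      using subspace_diff[OF sB b(1) c(1)] subspace_diff[OF sD b(2) c(2)] by metis
  qed
  then obtain P where P: "\<And>f. P f \<in> B \<and> f - P f \<in> disjoint_complement B" by metis
  have "P f = f" if "f \<in> B" for f
    using disjoint_complement_Int[of "f - P f" B] subspace_diff[OF sB that] P by simp
  then have "\<forall>f. P f = f \<longleftrightarrow> f \<in> B" using P by metis
  then show ?thesis using component_operator_of_band[OF B P] by blast
qed

section \<open>Suprema and infima of families of band projections\<close>

lemma band_Inter:
  assumes "\<And>A. A \<in> \<A> \<Longrightarrow> band A"
  shows "band (\<Inter>\<A>)"
proof -
  have "subspace (\<Inter>\<A>)"
    using assms by (intro subspace_Inter) (simp add: band_def riesz_ideal_def)
  moreover have "f \<in> \<Inter>\<A>" if "g \<in> \<Inter>\<A>" "\<bar>f\<bar> \<le> \<bar>g\<bar>" for f g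
    using that assms band_solid by blast
  moreover have "Sup S \<in> \<Inter>\<A>" if "S \<subseteq> \<Inter>\<A>" "S \<noteq> {}" "bdd_above S" for S
  proof
    fix A assume "A \<in> \<A>"
    with that show "Sup S \<in> A" using assms by (intro band_Sup) auto
  qed
  ultimately show ?thesis unfolding band_def riesz_ideal_def by auto
qed

text \<open>The common fixed points form a band, as an intersection of bands, and the projection onto it is
  the infimum because the order is inclusion of fixed points. This also shows that the definite
  description is well defined.\<close>

lemma bp_Inf_component_operator:
  assumes "\<And>P. P \<in> \<P> \<Longrightarrow> component_operator P"
  shows "component_operator (bp_Inf \<P>)" "bp_Inf \<P> f = f \<longleftrightarrow> (\<forall>P\<in>\<P>. P f = f)"
proof -
  define B where "B = (\<Inter>P\<in>\<P>. {f. P f = f})"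
  have "band B"
    unfolding B_def using band_fixed_points assms by (intro band_Inter) auto
  then obtain Q where Q: "component_operator Q" and fixQ: "\<And>f. Q f = f \<longleftrightarrow> f \<in> B"
    using band_component_operator_exists by blast
  have "bp_Inf \<P> = Q"
    unfolding bp_Inf_def band_projection_iff_component_operator
  proof (rule the_equality)
    show *: "component_operator Q \<and> (\<forall>P\<in>\<P>. op_le Q P) \<and>
      (\<forall>R. component_operator R \<and> (\<forall>P\<in>\<P>. op_le R P) \<longrightarrow> op_le R Q)"
      using Q fixQ assms by (auto simp: op_le_iff_fixed B_def)
    fix R assume R: "component_operator R \<and> (\<forall>P\<in>\<P>. op_le R P) \<and>
      (\<forall>S. component_operator S \<and> (\<forall>P\<in>\<P>. op_le S P) \<longrightarrow> op_le S R)"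
    then have "op_le R Q" "op_le Q R" using * by auto
    then show "R = Q" using R Q by (intro component_operator_eqI) (auto simp: op_le_iff_fixed)
  qed
  then show "component_operator (bp_Inf \<P>)" "bp_Inf \<P> f = f \<longleftrightarrow> (\<forall>P\<in>\<P>. P f = f)"
    using Q fixQ by (auto simp: B_def)
qed

lemma op_le_compl: "op_le (\<lambda>f. f - P f) (\<lambda>f. f - Q f) \<longleftrightarrow> op_le Q P"
  by (simp add: op_le_def)

text \<open>Complementation reverses the order, so the supremum is the complement of the infimum of the
  complements, and kernels become fixed points.\<close>

lemma bp_Sup_component_operator:
  assumes "\<And>P. P \<in> \<P> \<Longrightarrow> component_operator P"
  shows "component_operator (bp_Sup \<P>)" "bp_Sup \<P> f = 0 \<longleftrightarrow> (\<forall>P\<in>\<P>. P f = 0)"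
proof -
  define C :: "('a \<Rightarrow> 'a) \<Rightarrow> 'a \<Rightarrow> 'a" where "C P = (\<lambda>f. f - P f)" for P
  have CC: "C (C P) = P" for P by (simp add: C_def)
  have C: "component_operator (C P)" if "component_operator P" for P
    using component_operator_compl[OF that] by (simp add: C_def)
  have leC: "op_le (C P) (C Q) \<longleftrightarrow> op_le Q P" for P Q by (simp add: C_def op_le_compl)
  have CP: "component_operator P" if "P \<in> C ` \<P>" for P using that C assms by blast
  define Q where "Q = C (bp_Inf (C ` \<P>))"
  note I = bp_Inf_component_operator[of "C ` \<P>", OF CP]
  have Q: "component_operator Q" unfolding Q_def by (rule C[OF I(1)])
  have kerQ: "Q f = 0 \<longleftrightarrow> (\<forall>P\<in>\<P>. P f = 0)" for f
    using I(2)[of f] by (auto simp: Q_def C_def)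
  have lub: "op_le Q R \<longleftrightarrow> (\<forall>P\<in>\<P>. op_le P R)" if R: "component_operator R" for R
  proof -
    have "op_le Q R \<longleftrightarrow> op_le (C R) (bp_Inf (C ` \<P>))"
      using leC[of R Q] by (simp add: Q_def CC)
    also have "\<dots> \<longleftrightarrow> (\<forall>P\<in>\<P>. op_le (C R) (C P))"
      using C[OF R] I by (auto simp: op_le_iff_fixed C assms)
    finally show ?thesis by (simp add: leC)
  qed
  have "bp_Sup \<P> = Q"
    unfolding bp_Sup_def band_projection_iff_component_operator
  proof (rule the_equality)
    show *: "component_operator Q \<and> (\<forall>P\<in>\<P>. op_le P Q) \<and>
      (\<forall>R. component_operator R \<and> (\<forall>P\<in>\<P>. op_le P R) \<longrightarrow> op_le Q R)"
      using Q lub by (auto simp: lub[OF Q, symmetric] op_le_def)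
    fix R assume R: "component_operator R \<and> (\<forall>P\<in>\<P>. op_le P R) \<and>
      (\<forall>S. component_operator S \<and> (\<forall>P\<in>\<P>. op_le P S) \<longrightarrow> op_le R S)"
    then have "op_le R Q" "op_le Q R" using * by auto
    then show "R = Q" using R Q by (intro component_operator_eqI) (auto simp: op_le_iff_fixed)
  qed
  then show "component_operator (bp_Sup \<P>)" "bp_Sup \<P> f = 0 \<longleftrightarrow> (\<forall>P\<in>\<P>. P f = 0)"
    using Q kerQ by auto
qed

lemma bp_Sup_fixed:
  assumes "\<And>P. P \<in> \<P> \<Longrightarrow> component_operator P" and "Q \<in> \<P>" "Q f = f"
  shows "bp_Sup \<P> f = f"
proof -
  note S = bp_Sup_component_operator[of \<P>, OF assms(1)]
  have "bp_Sup \<P> (f - bp_Sup \<P> f) = 0" by (simp add: component_operator_simps[OF S(1)])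
  then have "Q (f - bp_Sup \<P> f) = 0" using S(2) assms(2) by blast
  then show ?thesis
    using component_operator_commute[OF assms(1)[OF assms(2)] S(1)] assms(3)
    by (simp add: component_operator_simps[OF assms(1)[OF assms(2)]])
qed

lemma bp_Inf_family:
  assumes "\<And>n. n \<in> N \<Longrightarrow> component_operator (P n)"
  shows "component_operator (bp_Inf (P ` N))"
    and "bp_Inf (P ` N) f = f \<longleftrightarrow> (\<forall>n\<in>N. P n f = f)"
  using bp_Inf_component_operator[of "P ` N"] assms by auto

lemma bp_Sup_family:
  assumes "\<And>n. n \<in> N \<Longrightarrow> component_operator (P n)"
  shows "component_operator (bp_Sup (P ` N))"
    and "bp_Sup (P ` N) f = 0 \<longleftrightarrow> (\<forall>n\<in>N. P n f = 0)"
    and "n \<in> N \<Longrightarrow> P n f = f \<Longrightarrow> bp_Sup (P ` N) f = f"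
  using bp_Sup_component_operator[of "P ` N"] bp_Sup_fixed[of "P ` N" "P n" f] assms by auto

section \<open>The upper limit minus the lower limit\<close>

theorem theorem3p3:
  fixes P :: "nat \<Rightarrow> 'a::dedekind_complete_riesz_space \<Rightarrow> 'a"
  assumes "\<And>n. n \<ge> 1 \<Longrightarrow> band_projection (P n)"
  shows "(\<lambda>f. bp_limsup P f - bp_liminf P f) =
         bp_limsup (\<lambda>n. P n \<circ> (\<lambda>f. f - P (n + 1) f))"
proof -
  define D where "D = (\<lambda>n. P n \<circ> (\<lambda>f. f - P (n + 1) f))"
  have P: "component_operator (P n)" if "n \<ge> 1" for n
    using assms[OF that] by (simp add: band_projection_iff_component_operator)
  have D: "component_operator (D n)" if "n \<ge> 1" for n
    unfolding D_def by (intro component_operator_comp component_operator_compl P) (use that in auto)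
  define A where "A k = bp_Sup (P ` {k..})" for k
  define I where "I k = bp_Inf (P ` {k..})" for k
  define S where "S k = bp_Sup (D ` {k..})" for k
  define L where "L = bp_limsup P"
  define l where "l = bp_liminf P"
  define M where "M = bp_limsup D"
  have A: "component_operator (A k)" and kerA: "A k f = 0 \<longleftrightarrow> (\<forall>n\<ge>k. P n f = 0)"
    and fixA: "n \<ge> k \<Longrightarrow> P n f = f \<Longrightarrow> A k f = f" if "k \<ge> 1" for k n f
    using bp_Sup_family[where P = P and N = "{k..}"] P that by (simp_all add: A_def Ball_def)
  have I: "component_operator (I k)" and fixI: "I k f = f \<longleftrightarrow> (\<forall>n\<ge>k. P n f = f)"
    if "k \<ge> 1" for k f
    using bp_Inf_family[where P = P and N = "{k..}"] P that by (simp_all add: I_def Ball_def)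
  have S: "component_operator (S k)" and kerS: "S k f = 0 \<longleftrightarrow> (\<forall>n\<ge>k. D n f = 0)"
    if "k \<ge> 1" for k f
    using bp_Sup_family[where P = D and N = "{k..}"] D that by (simp_all add: S_def Ball_def)
  have L: "component_operator L" and fixL: "L f = f \<longleftrightarrow> (\<forall>k\<ge>1. A k f = f)" for f
    using bp_Inf_family[where P = A and N = "{1..}"] A
    by (simp_all add: L_def bp_limsup_def A_def[abs_def] Ball_def)
  have M: "component_operator M" and fixM: "M f = f \<longleftrightarrow> (\<forall>k\<ge>1. S k f = f)" for f
    using bp_Inf_family[where P = S and N = "{1..}"] S
    by (simp_all add: M_def bp_limsup_def S_def[abs_def] Ball_def)
  have l: "component_operator l" and kerl: "l f = 0 \<longleftrightarrow> (\<forall>k\<ge>1. I k f = 0)"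
    and fixl: "k \<ge> 1 \<Longrightarrow> I k f = f \<Longrightarrow> l f = f" for f k
    using bp_Sup_family[where P = I and N = "{1..}"] I
    by (simp_all add: l_def bp_liminf_def I_def[abs_def] Ball_def)
  note simps = component_operator_simps and comm = component_operator_commute

  \<comment> \<open>This is the core of the inclusion \<open>L - l \<le> M\<close>: without descents from \<open>k\<close> on, the vector \<open>P n h\<close>
    is fixed by all later \<open>P m\<close>, so it lies in the range of \<open>l\<close> and must vanish.\<close>
  have zero: "h = 0" if h: "L h = h" "l h = 0" "S k h = 0" and k: "k \<ge> 1" for h k
  proof -
    have no_descent: "P (Suc n) (P n h) = P n h" if n: "n \<ge> k" for n
    proof -
      have "D n h = 0" using kerS[OF k] h(3) n by blast
      then show ?thesis
        using n k comm[OF P[of n] P[of "Suc n"], of h] by (simp add: D_def simps[OF P])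
    qed
    have "P n h = 0" if n: "n \<ge> k" for n
    proof -
      have n1: "n \<ge> 1" using n k by simp
      have "P m (P n h) = P n h" if "m \<ge> n" for m
        using that
      proof (induction m rule: dec_induct)
        case base
        show ?case by (simp add: simps(6)[OF P[OF n1]])
      next
        case (step m)
        have m: "m \<ge> 1" "m \<ge> k" using step n k by auto
        have "P (Suc m) (P n h) = P (Suc m) (P m (P n h))" using step by simp
        also have "\<dots> = P n (P (Suc m) (P m h))"
          using comm[OF P[OF n1] P[OF m(1)]] comm[OF P[OF n1] P[of "Suc m"]] by simp
        also have "\<dots> = P n (P m h)" using no_descent m by simp
        also have "\<dots> = P n h" using comm[OF P[OF n1] P[OF m(1)]] step by simp
        finally show ?case .
      qed
      then have "l (P n h) = P n h" using fixl[OF n1] fixI[OF n1] by blast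
      then show ?thesis using comm[OF l P[OF n1], of h] h(2) by (simp add: simps[OF P[OF n1]])
    qed
    then have "A k h = 0" using kerA[OF k] by blast
    moreover have "A k h = h" using fixL h(1) k by blast
    ultimately show ?thesis by simp
  qed

  have up: "M g = g" if g: "L g = g" "l g = 0" for g
  proof -
    have "S k g = g" if k: "k \<ge> 1" for k
    proof -
      have "g - S k g = 0"
        by (rule zero[OF _ _ _ k])
          (simp_all add: g simps[OF L] simps[OF l] simps[OF S[OF k]]
            comm[OF L S[OF k]] comm[OF l S[OF k]])
      then show ?thesis by simp
    qed
    then show ?thesis using fixM by blast
  qed

  \<comment> \<open>In both parts the vector that has to vanish stays in the range of \<open>S k\<close>, since all
    projections commute, but the sequence is constant on it from \<open>k\<close> on, so \<open>S k\<close> annihilates it.\<close>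
  have down: "L g = g" "l g = 0" if g: "M g = g" for g
  proof -
    have Sg: "S k g = g" if "k \<ge> 1" for k using fixM g that by blast
    have "A k g = g" if k: "k \<ge> 1" for k
    proof -
      define h where "h = g - A k g"
      have "A k h = 0" by (simp add: h_def simps[OF A[OF k]])
      then have Ph: "P n h = 0" if "n \<ge> k" for n using kerA[OF k] that by blast
      have "D n h = 0" if "n \<ge> k" for n
        using Ph that k by (simp add: D_def simps[OF P])
      then have "S k h = 0" using kerS[OF k] by blast
      moreover have "S k h = h"
        using Sg[OF k] by (simp add: h_def simps[OF S[OF k]] comm[OF S[OF k] A[OF k]])
      ultimately show ?thesis by (simp add: h_def)
    qed
    then show "L g = g" using fixL by blast
    have "I k g = 0" if k: "k \<ge> 1" for k
    proof -
      have "I k (I k g) = I k g" by (simp add: simps(6)[OF I[OF k]])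
      then have fixed: "P n (I k g) = I k g" if "n \<ge> k" for n using fixI[OF k] that by blast
      have "D n (I k g) = 0" if "n \<ge> k" for n
        using fixed that k by (simp add: D_def simps[OF P])
      then have "S k (I k g) = 0" using kerS[OF k] by blast
      moreover have "S k (I k g) = I k g" using Sg[OF k] by (simp add: comm[OF S[OF k] I[OF k]])
      ultimately show ?thesis by simp
    qed
    then show "l g = 0" using kerl by blast
  qed

  \<comment> \<open>The lower limit is below the upper one: a vector fixed by \<open>P n\<close> for all \<open>n \<ge> k\<close> is fixed by
    every \<open>A j\<close>, since the index \<open>max j k\<close> is in both ranges.\<close>
  have lL: "l (L f) = l f" for f
  proof -
    have "I k (f - L f) = 0" if k: "k \<ge> 1" for k
    proof -
      define u where "u = I k (f - L f)"
      have "I k u = u" by (simp add: u_def simps(6)[OF I[OF k]])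
      then have Pu: "P n u = u" if "n \<ge> k" for n using fixI[OF k] that by blast
      have "A j u = u" if "j \<ge> 1" for j
        using fixA[OF that, of "max j k" u] Pu by simp
      then have "L u = u" using fixL by blast
      moreover have "L u = 0" by (simp add: u_def comm[OF L I[OF k]] simps[OF L] simps[OF I[OF k]])
      ultimately show ?thesis by (simp add: u_def)
    qed
    then have "l (f - L f) = 0" using kerl by blast
    then show ?thesis by (simp add: simps[OF l])
  qed

  \<comment> \<open>By \<open>up\<close> and \<open>down\<close> the range of \<open>M\<close> is the range of the projection \<open>L - l\<close>. To compare values,
    split \<open>f\<close> into \<open>M f\<close> and a vector in the kernel of \<open>M\<close>, on which \<open>L - l\<close> must vanish.\<close>
  have "L f - l f = M f" for f
  proof -
    define g where "g = f - M f"
    define h where "h = L g - l g"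
    have "M h = h"
      by (rule up) (simp_all add: h_def simps[OF L] simps[OF l] comm[OF L l] lL)
    moreover have "M h = 0"
      by (simp add: h_def g_def simps[OF M] comm[OF M L] comm[OF M l] simps(4)[OF L] simps(4)[OF l])
    moreover have "L (M f) = M f" "l (M f) = 0" using down simps(6)[OF M] by auto
    ultimately show ?thesis by (simp add: algebra_simps h_def g_def simps[OF L] simps[OF l])
  qed
  then show ?thesis by (auto simp: L_def l_def M_def D_def)
qed

end
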